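(* Let $X$ be a Banach space with a Schauder basis $\{x_n\}$ and let $P$ be the positive cone of $\{x_n\}$. If $P$ is reflexive, then $\{x_n\}$ is boundedly complete on $P$.
   Context: All spaces are real. $B_X$ is the closed unit ball of $X$. The positive cone of a Schauder basis $\{x_n\}$ is $P=\{\sum_{i=1}^\infty\lambda_i x_i : \lambda_i\ge 0\text{ for each } i\}$ (series convergent in $X$). $P$ is reflexive if $P\cap B_X$ is weakly compact. $\{x_n\}$ is boundedly complete on $P$ if for each sequence $\{a_n\}$ of nonnegative real numbers, $\sup_{n\in\mathbb{N}}\|\sum_{i=1}^n a_i x_i\|<+\infty$ implies that $\sum_{i=1}^\infty a_i x_i$ converges in $X$, so that $\sum_{i=1}^\infty a_i x_i\in P$. *)

theory Defs
  imports "HOL-Analysis.Analysis"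
begin

text \<open>Sequences are indexed from \<open>0\<close>, so \<open>x\<^sub>1, x\<^sub>2, \<dots>\<close> on paper is \<open>e 0, e 1, \<dots>\<close> here.
  Convergence of series (\<open>sums\<close>, \<open>summable\<close>) is in the norm and in the given order.\<close>

definition schauder_basis :: "(nat \<Rightarrow> 'a::real_normed_vector) \<Rightarrow> bool" where
  "schauder_basis e \<longleftrightarrow> (\<forall>v. \<exists>!a::nat \<Rightarrow> real. (\<lambda>n. a n *\<^sub>R e n) sums v)"

definition positive_cone :: "(nat \<Rightarrow> 'a::real_normed_vector) \<Rightarrow> 'a set" where
  "positive_cone e =
     {v. \<exists>a::nat \<Rightarrow> real. (\<forall>n. 0 \<le> a n) \<and> (\<lambda>n. a n *\<^sub>R e n) sums v}"

text \<open>The coarsest topology on the whole space for which every bounded linear functional is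
  continuous: the preimages below form a subbase.\<close>

definition weak_topology :: "'a::real_normed_vector topology" where
  "weak_topology =
     topology_generated_by {f -` U |(f :: 'a \<Rightarrow> real) U. bounded_linear f \<and> open U}"

definition reflexive_cone :: "'a::real_normed_vector set \<Rightarrow> bool" where
  "reflexive_cone P \<longleftrightarrow> compactin weak_topology (P \<inter> cball 0 1)"

definition boundedly_complete_on_cone :: "(nat \<Rightarrow> 'a::real_normed_vector) \<Rightarrow> bool" where
  "boundedly_complete_on_cone e \<longleftrightarrow>
     (\<forall>a::nat \<Rightarrow> real. (\<forall>n. 0 \<le> a n) \<longrightarrow>
        bdd_above (range (\<lambda>n. norm (\<Sum>i\<le>n. a i *\<^sub>R e i))) \<longrightarrow>
        summable (\<lambda>n. a n *\<^sub>R e n))"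

end

theory Submission
  imports Defs
begin

text \<open>
  Let \<open>a\<close> be a nonnegative sequence whose partial sums \<open>\<Sum>i\<le>n. a i *\<^sub>R e i\<close> are bounded in norm by
  \<open>M > 0\<close>. Divided by \<open>M\<close>, they lie in \<open>positive_cone e \<inter> cball 0 1\<close>, which is weakly compact. For
  each \<open>i\<close>, all but finitely many of the scaled partial sums have \<open>i\<close>-th coordinate \<open>a i / M\<close>. The
  coordinates are bounded linear functionals, so the condition that the \<open>i\<close>-th coordinate be
  \<open>a i / M\<close> defines a weakly closed set, and any finitely many of these sets meet the compact set.
  By compactness some vector \<open>v\<close> has all of its coordinates equal to \<open>a i / M\<close>. Since \<open>e\<close> is a
  basis, the expansion of \<open>v\<close> converges, and \<open>M\<close> times it is the series to be summed.

  The substance lies in \<open>bounded_linear_coord\<close>, Banach's theorem that the coordinate functionals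
  are continuous: a basis is here only required to give every vector a unique expansion. It is
  derived from a lemma of Zabreiko (\<open>countably_subadditive_seminorm_bounded\<close>): on a Banach space
  every finite countably subadditive seminorm is dominated by a multiple of the norm. The lemma is
  applied to the supremum of the norms of the partial expansions. That this seminorm is countably
  subadditive (\<open>basis_norm_countably_subadditive\<close>) amounts to summing expansions coordinatewise,
  and uniqueness of the expansion identifies the result.
\<close>

section \<open>Countably subadditive seminorms on Banach spaces\<close>

text \<open>
  The sublevel sets of \<open>p\<close> at the natural numbers cover the space, so by Baire the closure of one
  of them contains a ball \<open>ball x0 r\<close>. The sublevel set is convex and symmetric, and
  \<open>v = ((x0 + v) - (x0 - v)) / 2\<close>, which moves the ball to the origin.
\<close>
lemma seminorm_small_on_dense_part_of_ball:
  fixes p :: "'a::banach \<Rightarrow> real"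
  assumes scale: "\<And>c x. p (c *\<^sub>R x) = \<bar>c\<bar> * p x"
    and triangle: "\<And>x y. p (x + y) \<le> p x + p y"
  obtains k r where "0 < r" and "0 \<le> k" and "ball 0 r \<subseteq> closure {x. p x \<le> k}"
proof -
  define A where "A = (\<lambda>k::nat. closure {x. p x \<le> real k})"
  have "\<exists>k. interior (A k) \<noteq> {}"
  proof (rule ccontr)
    assume "\<not> ?thesis"
    hence empty: "\<And>k. interior (A k) = {}" by blast
    have "euclidean interior_of \<Union>(range A) = {}"
      by (rule Baire_category_alt)
        (use empty in \<open>auto simp: completely_metrizable_space_euclidean A_def\<close>)
    moreover have "\<Union>(range A) = UNIV"
      using real_arch_simple closure_subset unfolding A_def by fast
    ultimately show False by simp
  qed
  then obtain k x0 where "x0 \<in> interior (A k)" by blast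
  then obtain r where r: "r > 0" "ball x0 r \<subseteq> A k"
    using mem_interior by blast
  have "v \<in> closure {x. p x \<le> real k}" if "v \<in> ball 0 r" for v
  proof -
    have "x0 + v \<in> A k" "x0 - v \<in> A k"
      using that r(2) by (auto simp: subset_iff dist_norm)
    then obtain y z where yz: "\<And>n. p (y n) \<le> real k" "\<And>n. p (z n) \<le> real k"
      "y \<longlonglongrightarrow> x0 + v" "z \<longlonglongrightarrow> x0 - v"
      unfolding A_def closure_sequential by auto
    have "(\<lambda>n. (1/2) *\<^sub>R (y n + (-1) *\<^sub>R z n)) \<longlonglongrightarrow> (1/2) *\<^sub>R ((x0 + v) + (-1) *\<^sub>R (x0 - v))"
      by (intro tendsto_intros yz)
    also have "(1/2) *\<^sub>R ((x0 + v) + (-1) *\<^sub>R (x0 - v)) = v"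
      by (simp add: algebra_simps flip: scaleR_add_left)
    finally have "(\<lambda>n. (1/2) *\<^sub>R (y n + (-1) *\<^sub>R z n)) \<longlonglongrightarrow> v" .
    moreover have "p ((1/2) *\<^sub>R (y n + (-1) *\<^sub>R z n)) \<le> real k" for n
      using triangle[of "y n" "(-1) *\<^sub>R z n"] yz(1,2)[of n] scale[of "-1" "z n"]
        scale[of "1/2" "y n + (-1) *\<^sub>R z n"] by linarith
    ultimately show ?thesis unfolding closure_sequential mem_Collect_eq
      by (intro exI conjI allI)
  qed
  with r(1) show ?thesis by (intro that[of r "real k"]) auto
qed

text \<open>
  Zabreiko's lemma, by the successive approximation known from the open mapping theorem: every
  \<open>u\<close> can be approximated as closely as desired by some \<open>w\<close> with \<open>p w \<le> C * norm u\<close>. Approximating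
  the remainder over and over, with errors halving each time, writes \<open>u\<close> as a series whose terms
  have \<open>p\<close>-values dominated by a geometric series, and countable subadditivity bounds \<open>p u\<close>.
\<close>
lemma countably_subadditive_seminorm_bounded:
  fixes p :: "'a::banach \<Rightarrow> real"
  assumes scale: "\<And>c x. p (c *\<^sub>R x) = \<bar>c\<bar> * p x"
    and subadd: "\<And>f x. f sums x \<Longrightarrow> summable (\<lambda>n. p (f n)) \<Longrightarrow> p x \<le> (\<Sum>n. p (f n))"
  obtains M where "\<And>x. p x \<le> M * norm x"
proof -
  have p0: "p 0 = 0" using scale[of 0 0] by simp
  have triangle: "p (x + y) \<le> p x + p y" for x y
  proof -
    define f where "f = (\<lambda>n::nat. if n = 0 then x else if n = 1 then y else 0)"
    have "f sums (\<Sum>n\<in>{0,1}. f n)" by (rule sums_finite) (auto simp: f_def)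
    hence f: "f sums (x + y)" by (simp add: f_def)
    have "(\<lambda>n. p (f n)) sums (\<Sum>n\<in>{0,1}. p (f n))"
      by (rule sums_finite) (auto simp: f_def p0)
    hence "(\<lambda>n. p (f n)) sums (p x + p y)" by (simp add: f_def)
    thus ?thesis using subadd[OF f] by (simp add: sums_iff)
  qed
  obtain k r where r: "0 < r" and k: "0 \<le> k" and ball: "ball 0 r \<subseteq> closure {x. p x \<le> k}"
    using seminorm_small_on_dense_part_of_ball[OF scale triangle] by blast
  define C where "C = 2 * k / r"
  have approx: "\<exists>w. p w \<le> C * norm u \<and> norm (u - w) < d" if d: "d > 0" for u d
  proof (cases "u = 0")
    case True
    thus ?thesis using d p0 by (intro exI[of _ 0]) auto
  next
    case False
    \<comment> \<open>Scaling \<open>u\<close> to norm \<open>r / 2\<close> puts it inside the ball.\<close>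
    define s where "s = 2 * norm u / r"
    have s: "s > 0" using False r by (simp add: s_def)
    have "norm (u /\<^sub>R s) = r / 2" using False r by (simp add: s_def)
    hence "u /\<^sub>R s \<in> closure {x. p x \<le> k}" using ball r by auto
    then obtain w where w: "p w \<le> k" "dist w (u /\<^sub>R s) < d / s"
      using divide_pos_pos[OF d s] unfolding closure_approachable by blast
    have "u - s *\<^sub>R w = s *\<^sub>R (u /\<^sub>R s - w)"
      using s by (simp add: scaleR_right_diff_distrib)
    hence "norm (u - s *\<^sub>R w) = s * dist w (u /\<^sub>R s)"
      using s by (simp add: dist_norm norm_minus_commute)
    also have "\<dots> < d" using w(2) s by (simp add: field_simps)
    finally have "norm (u - s *\<^sub>R w) < d" .
    moreover have "p (s *\<^sub>R w) \<le> C * norm u"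
    proof -
      have "p (s *\<^sub>R w) = s * p w" using s scale by simp
      also have "\<dots> \<le> s * k" using s w(1) by simp
      also have "\<dots> = C * norm u" by (simp add: s_def C_def)
      finally show ?thesis .
    qed
    ultimately show ?thesis by blast
  qed
  have "p u \<le> 2 * C * norm u" for u
  proof (cases "u = 0")
    case False
    define W where "W = (\<lambda>x d. SOME w. p w \<le> C * norm x \<and> norm (x - w) < d)"
    have W: "p (W x d) \<le> C * norm x \<and> norm (x - W x d) < d" if d: "d > 0" for x d
      unfolding W_def by (rule someI_ex[OF approx[OF d]])
    \<comment> \<open>\<open>R n\<close> is the remainder after \<open>n\<close> approximation steps.\<close>
    define R where "R = rec_nat u (\<lambda>n x. x - W x (norm u * (1/2) ^ Suc n))"
    have R0: "R 0 = u" and RS: "R (Suc n) = R n - W (R n) (norm u * (1/2) ^ Suc n)" for n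
      by (simp_all add: R_def)
    have R_le: "norm (R n) \<le> norm u * (1/2) ^ n" for n
    proof (cases n)
      case 0
      thus ?thesis by (simp add: R0)
    next
      case (Suc m)
      show ?thesis unfolding Suc RS
        by (rule less_imp_le, rule conjunct2, rule W) (use False in simp)
    qed
    have "(\<lambda>n. norm u * (1/2) ^ n) \<longlonglongrightarrow> norm u * 0"
      by (intro tendsto_intros LIMSEQ_power_zero) simp
    hence "R \<longlonglongrightarrow> 0"
      by (intro Lim_null_comparison[of R]) (use R_le in auto)
    hence sums_u: "(\<lambda>n. R n - R (Suc n)) sums u"
      using telescope_sums'[of R 0] by (simp add: R0)
    have p_le: "p (R n - R (Suc n)) \<le> C * norm u * (1/2) ^ n" for n
    proof -
      have "p (R n - R (Suc n)) \<le> C * norm (R n)"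
        using W[of "norm u * (1/2) ^ Suc n" "R n"] False by (simp add: RS)
      also have "\<dots> \<le> C * (norm u * (1/2) ^ n)"
        using R_le k r by (intro mult_left_mono) (auto simp: C_def)
      finally show ?thesis by (simp add: mult_ac)
    qed
    have "p x \<ge> 0" for x
      using triangle[of x "(-1) *\<^sub>R x"] scale[of "-1" x] p0 by simp
    moreover have geo: "(\<lambda>n. C * norm u * (1/2) ^ n) sums (C * norm u * 2)"
      using sums_mult[OF geometric_sums[of "1/2::real"], of "C * norm u"] by simp
    ultimately have summ: "summable (\<lambda>n. p (R n - R (Suc n)))"
      by (intro summable_comparison_test'[OF sums_summable[OF geo], of 0]) (use p_le in auto)
    have "p u \<le> (\<Sum>n. p (R n - R (Suc n)))" by (rule subadd[OF sums_u summ])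
    also have "\<dots> \<le> C * norm u * 2"
      using suminf_le[OF p_le summ sums_summable[OF geo]] geo by (simp add: sums_iff)
    finally show ?thesis by simp
  qed (simp add: p0)
  thus ?thesis by (rule that)
qed

section \<open>Continuity of the coordinates of a Schauder basis\<close>

definition coord :: "(nat \<Rightarrow> 'a::real_normed_vector) \<Rightarrow> 'a \<Rightarrow> nat \<Rightarrow> real" where
  "coord e v = (THE a. (\<lambda>n. a n *\<^sub>R e n) sums v)"

definition partial_expansion :: "(nat \<Rightarrow> 'a::real_normed_vector) \<Rightarrow> nat \<Rightarrow> 'a \<Rightarrow> 'a" where
  "partial_expansion e n v = (\<Sum>i<n. coord e v i *\<^sub>R e i)"

text \<open>
  The classical renorming for which the partial expansions are contractions. It is meaningful only
  when the partial expansions of each vector are bounded, as they are for a Schauder basis.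
\<close>
definition basis_norm :: "(nat \<Rightarrow> 'a::real_normed_vector) \<Rightarrow> 'a \<Rightarrow> real" where
  "basis_norm e v = (SUP n. norm (partial_expansion e n v))"

lemma coord_sums:
  assumes "schauder_basis e"
  shows "(\<lambda>n. coord e v n *\<^sub>R e n) sums v"
  unfolding coord_def
  by (rule theI'[of "\<lambda>a. (\<lambda>n. a n *\<^sub>R e n) sums v"])
    (use assms in \<open>simp add: schauder_basis_def\<close>)

lemma coord_eqI:
  assumes "schauder_basis e" and "(\<lambda>n. a n *\<^sub>R e n) sums v"
  shows "coord e v = a"
  using assms coord_sums[OF assms(1)] unfolding schauder_basis_def by blast

lemma coord_add:
  assumes "schauder_basis e"
  shows "coord e (u + v) i = coord e u i + coord e v i"
proof -
  have "(\<lambda>n. (coord e u n + coord e v n) *\<^sub>R e n) sums (u + v)"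
    using sums_add[OF coord_sums coord_sums, OF assms assms] by (simp add: scaleR_add_left)
  from coord_eqI[OF assms this] show ?thesis by simp
qed

lemma coord_scaleR:
  assumes "schauder_basis e"
  shows "coord e (c *\<^sub>R v) i = c * coord e v i"
proof -
  have "(\<lambda>n. (c * coord e v n) *\<^sub>R e n) sums (c *\<^sub>R v)"
    using bounded_linear.sums[OF bounded_linear_scaleR_right coord_sums, OF assms] by simp
  from coord_eqI[OF assms this] show ?thesis by simp
qed

lemma coord_finite_sum:
  assumes "schauder_basis e" and "finite N"
  shows "coord e (\<Sum>i\<in>N. a i *\<^sub>R e i) = (\<lambda>i. if i \<in> N then a i else 0)"
  by (rule coord_eqI[OF assms(1)])
    (use sums_If_finite_set[OF assms(2), of "\<lambda>i. a i *\<^sub>R e i"] in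
      \<open>simp add: if_distrib[of "\<lambda>c. c *\<^sub>R _"] cong: if_cong\<close>)

lemma schauder_basis_nonzero:
  assumes "schauder_basis e"
  shows "e i \<noteq> 0"
proof
  assume "e i = 0"
  hence "(\<Sum>j\<in>{i}. 1 *\<^sub>R e j) = 0" by simp
  hence "coord e 0 i = 1" using coord_finite_sum[OF assms, of "{i}" "\<lambda>_. 1"] by simp
  thus False using coord_scaleR[OF assms, of 0 0 i] by simp
qed

lemma partial_expansion_tendsto:
  assumes "schauder_basis e"
  shows "(\<lambda>n. partial_expansion e n v) \<longlonglongrightarrow> v"
  using coord_sums[OF assms, of v] unfolding sums_def partial_expansion_def .

lemma norm_partial_expansion_le:
  assumes "schauder_basis e"
  shows "norm (partial_expansion e n v) \<le> basis_norm e v"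
proof -
  have "Bseq (\<lambda>n. partial_expansion e n v)"
    using partial_expansion_tendsto[OF assms] by (rule convergent_imp_Bseq[OF convergentI])
  hence "bdd_above (range (\<lambda>n. norm (partial_expansion e n v)))"
    by (auto simp: Bseq_def intro: bdd_aboveI2)
  thus ?thesis unfolding basis_norm_def by (intro cSUP_upper) auto
qed

lemma norm_le_basis_norm:
  assumes "schauder_basis e"
  shows "norm v \<le> basis_norm e v"
  by (rule tendsto_upperbound[OF tendsto_norm[OF partial_expansion_tendsto[OF assms]]])
    (simp_all add: norm_partial_expansion_le[OF assms])

lemma coord_le_basis_norm:
  assumes "schauder_basis e"
  shows "\<bar>coord e v i\<bar> * norm (e i) \<le> 2 * basis_norm e v"
proof -
  have "coord e v i *\<^sub>R e i = partial_expansion e (Suc i) v - partial_expansion e i v"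
    by (simp add: partial_expansion_def)
  hence "\<bar>coord e v i\<bar> * norm (e i)
      = norm (partial_expansion e (Suc i) v - partial_expansion e i v)"
    by (metis norm_scaleR)
  also have "\<dots> \<le> basis_norm e v + basis_norm e v"
    using norm_triangle_ineq4 norm_partial_expansion_le[OF assms]
    by (meson add_mono order_trans)
  finally show ?thesis by simp
qed

lemma basis_norm_scaleR:
  assumes "schauder_basis e"
  shows "basis_norm e (c *\<^sub>R v) = \<bar>c\<bar> * basis_norm e v"
proof -
  have le: "basis_norm e (c *\<^sub>R v) \<le> \<bar>c\<bar> * basis_norm e v" for c v
  proof -
    have "norm (partial_expansion e n (c *\<^sub>R v)) = \<bar>c\<bar> * norm (partial_expansion e n v)" for n
      by (simp add: partial_expansion_def coord_scaleR[OF assms] flip: scaleR_scaleR scaleR_sum_right)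
    thus ?thesis
      unfolding basis_norm_def[of e "c *\<^sub>R v"]
      by (intro cSUP_least) (auto intro!: mult_left_mono norm_partial_expansion_le[OF assms])
  qed
  show ?thesis
  proof (cases "c = 0")
    case True
    have "0 \<le> basis_norm e (0 *\<^sub>R v)"
      using norm_le_basis_norm[OF assms] norm_ge_zero order_trans by blast
    with le[of 0 v] True show ?thesis by simp
  next
    case False
    have "\<bar>c\<bar> * basis_norm e v = \<bar>c\<bar> * basis_norm e (inverse c *\<^sub>R (c *\<^sub>R v))"
      using False by simp
    also have "\<dots> \<le> \<bar>c\<bar> * (\<bar>inverse c\<bar> * basis_norm e (c *\<^sub>R v))"
      by (intro mult_left_mono le) simp
    also have "\<dots> = basis_norm e (c *\<^sub>R v)" using False by (simp add: abs_inverse)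
    finally show ?thesis using le[of c v] by simp
  qed
qed

text \<open>
  Coordinates of the \<open>f j\<close> are controlled by \<open>basis_norm e (f j)\<close>, so they can be summed over \<open>j\<close>,
  giving candidate coordinates \<open>b\<close> for \<open>v\<close>. The \<open>n\<close>-th partial sum of \<open>\<Sum>i. b i *\<^sub>R e i\<close> differs
  from \<open>v\<close> by at most \<open>\<Sum>j. norm (partial_expansion e n (f j) - f j)\<close>. Each term vanishes as \<open>n\<close>
  grows and is dominated by \<open>2 * basis_norm e (f j)\<close>, so the error tends to zero by Tannery's
  theorem, and by uniqueness \<open>b\<close> is the coordinate sequence of \<open>v\<close>.
\<close>
lemma basis_norm_countably_subadditive:
  fixes e :: "nat \<Rightarrow> 'a::banach"
  assumes e: "schauder_basis e" and f: "f sums v"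
    and summ: "summable (\<lambda>j. basis_norm e (f j))"
  shows "basis_norm e v \<le> (\<Sum>j. basis_norm e (f j))"
proof -
  let ?S = "partial_expansion e"
  define b where "b = (\<lambda>i. \<Sum>j. coord e (f j) i)"
  have summ_coord: "summable (\<lambda>j. coord e (f j) i)" for i
  proof (rule summable_comparison_test'[of _ 0])
    show "summable (\<lambda>j. (2 / norm (e i)) * basis_norm e (f j))"
      by (rule summable_mult[OF summ])
    show "norm (coord e (f j) i) \<le> (2 / norm (e i)) * basis_norm e (f j)" for j
      using coord_le_basis_norm[OF e, of "f j" i] schauder_basis_nonzero[OF e, of i]
      by (simp add: field_simps)
  qed
  have S_sums: "(\<lambda>j. ?S n (f j)) sums (\<Sum>i<n. b i *\<^sub>R e i)" for n
    unfolding partial_expansion_def b_def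
    by (intro sums_sum bounded_linear.sums[OF bounded_linear_scaleR_left]
        summable_sums summ_coord)
  have err_le: "norm (?S n (f j) - f j) \<le> 2 * basis_norm e (f j)" for n j
    using norm_triangle_ineq4[of "?S n (f j)" "f j"]
      norm_partial_expansion_le[OF e, of n "f j"] norm_le_basis_norm[OF e, of "f j"] by linarith
  have summ2: "summable (\<lambda>j. 2 * basis_norm e (f j))" by (rule summable_mult[OF summ])
  have summ_err: "summable (\<lambda>j. norm (?S n (f j) - f j))" for n
    by (rule summable_comparison_test'[OF summ2, of 0]) (use err_le in auto)
  have err_tendsto: "(\<lambda>n. \<Sum>j. norm (?S n (f j) - f j)) \<longlonglongrightarrow> (\<Sum>j. 0)"
  proof (rule tannerys_theorem[THEN conjunct2, THEN conjunct2])
    show "(\<lambda>n. norm (?S n (f j) - f j)) \<longlonglongrightarrow> 0" for j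
      using partial_expansion_tendsto[OF e, of "f j"] by (simp add: LIM_zero_iff tendsto_norm_zero)
    show "\<forall>\<^sub>F (j, n) in at_top \<times>\<^sub>F at_top.
        norm (norm (?S n (f j) - f j)) \<le> 2 * basis_norm e (f j)"
      by (rule always_eventually) (use err_le in auto)
  qed (rule summ2, simp)
  have "norm ((\<Sum>i<n. b i *\<^sub>R e i) - v) \<le> (\<Sum>j. norm (?S n (f j) - f j))" for n
    using summable_norm[OF summ_err, of n] sums_diff[OF S_sums[of n] f] by (simp add: sums_iff)
  hence "\<forall>\<^sub>F n in sequentially.
      norm ((\<Sum>i<n. b i *\<^sub>R e i) - v) \<le> (\<Sum>j. norm (?S n (f j) - f j))"
    by (intro always_eventually allI)
  moreover have "(\<lambda>n. \<Sum>j. norm (?S n (f j) - f j)) \<longlonglongrightarrow> 0"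
    using err_tendsto by (simp only: suminf_zero)
  ultimately have "(\<lambda>n. (\<Sum>i<n. b i *\<^sub>R e i) - v) \<longlonglongrightarrow> 0"
    by (rule Lim_null_comparison)
  hence "(\<lambda>i. b i *\<^sub>R e i) sums v" by (simp add: sums_def LIM_zero_iff)
  hence "coord e v = b" by (rule coord_eqI[OF e])
  hence S_v: "(\<lambda>j. ?S n (f j)) sums ?S n v" for n
    using S_sums by (simp add: partial_expansion_def)
  have "norm (?S n v) \<le> (\<Sum>j. basis_norm e (f j))" for n
  proof -
    have "?S n v = (\<Sum>j. ?S n (f j))" using S_v by (simp add: sums_iff)
    also have "norm \<dots> \<le> (\<Sum>j. basis_norm e (f j))"
      by (rule norm_suminf_le[OF norm_partial_expansion_le[OF e] summ])
    finally show ?thesis .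
  qed
  thus ?thesis unfolding basis_norm_def[of e v] by (intro cSUP_least) auto
qed

text \<open>
  A coordinate is the coefficient of a difference of two consecutive partial expansions, so it is
  dominated by \<open>basis_norm\<close>, which Zabreiko's lemma bounds by a multiple of the norm.
\<close>
lemma bounded_linear_coord:
  fixes e :: "nat \<Rightarrow> 'a::banach"
  assumes e: "schauder_basis e"
  shows "bounded_linear (\<lambda>v. coord e v i)"
proof -
  obtain M where M: "\<And>v. basis_norm e v \<le> M * norm v"
    using countably_subadditive_seminorm_bounded
      [OF basis_norm_scaleR[OF e] basis_norm_countably_subadditive[OF e]] by blast
  show ?thesis
  proof (rule bounded_linear_intro[where K = "2 * M / norm (e i)"])
    fix v
    have "\<bar>coord e v i\<bar> * norm (e i) \<le> 2 * (M * norm v)"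
      using coord_le_basis_norm[OF e, of v i] M[of v] by linarith
    thus "norm (coord e v i) \<le> norm v * (2 * M / norm (e i))"
      using schauder_basis_nonzero[OF e, of i] by (simp add: field_simps)
  qed (simp_all add: coord_add[OF e] coord_scaleR[OF e])
qed

section \<open>Weak compactness and bounded completeness\<close>

lemma closedin_weak_topology_level_set:
  fixes f :: "'a::real_normed_vector \<Rightarrow> real"
  assumes "bounded_linear f"
  shows "closedin weak_topology {v. f v = c}"
proof -
  let ?B = "{f -` U |(f :: 'a \<Rightarrow> real) U. bounded_linear f \<and> open U}"
  have "f -` UNIV \<in> ?B" using assms by blast
  hence top: "topspace (weak_topology :: 'a topology) = UNIV"
    unfolding weak_topology_def topology_generated_by_topspace by auto
  have "openin weak_topology (f -` (- {c}))"
    unfolding weak_topology_def using assms by (intro topology_generated_by_Basis) blast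
  moreover have "f -` (- {c}) = UNIV - {v. f v = c}" by auto
  ultimately show ?thesis by (simp add: closedin_def top)
qed

theorem theorem6p2:
  fixes e :: "nat \<Rightarrow> 'a::banach"
  assumes "schauder_basis e"
    and "reflexive_cone (positive_cone e)"
  shows "boundedly_complete_on_cone e"
  unfolding boundedly_complete_on_cone_def
proof (intro allI impI)
  fix a :: "nat \<Rightarrow> real"
  assume nonneg: "\<forall>n. 0 \<le> a n"
    and bdd: "bdd_above (range (\<lambda>n. norm (\<Sum>i\<le>n. a i *\<^sub>R e i)))"
  from bdd obtain M0 where M0: "\<And>n. norm (\<Sum>i\<le>n. a i *\<^sub>R e i) \<le> M0"
    by (auto simp: bdd_above_def)
  \<comment> \<open>The bound \<open>M0\<close> may be zero, and a positive one is needed to divide by.\<close>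
  define M where "M = max 1 M0"
  have M: "M > 0" "\<And>n. norm (\<Sum>i\<le>n. a i *\<^sub>R e i) \<le> M"
    using M0 by (auto simp: M_def max.coboundedI2)
  let ?K = "positive_cone e \<inter> cball 0 1"
  define H where "H = (\<lambda>i. {v. coord e v i = a i / M})"
  define s where "s = (\<lambda>n. \<Sum>i\<le>n. (a i / M) *\<^sub>R e i)"
  have coord_s: "coord e (s n) i = a i / M" if "i \<le> n" for i n
    using that coord_finite_sum[OF assms(1), of "{..n}" "\<lambda>i. a i / M"] by (simp add: s_def)
  have s_in_K: "s n \<in> ?K" for n
  proof
    have "coord e (s n) i \<ge> 0" for i
      using coord_finite_sum[OF assms(1), of "{..n}" "\<lambda>i. a i / M"] nonneg M(1)
      by (simp add: s_def)
    thus "s n \<in> positive_cone e"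
      unfolding positive_cone_def using coord_sums[OF assms(1)] by blast
    have "s n = (\<Sum>i\<le>n. a i *\<^sub>R e i) /\<^sub>R M"
      by (simp add: s_def scaleR_sum_right divide_inverse mult.commute)
    thus "s n \<in> cball 0 1" using M(1) M(2)[of n] by (simp add: field_simps)
  qed
  have "?K \<inter> \<Inter>(range H) \<noteq> {}"
  proof -
    have "closedin weak_topology C" if "C \<in> range H" for C
      using that closedin_weak_topology_level_set bounded_linear_coord[OF assms(1)]
      by (auto simp: H_def)
    moreover have "?K \<inter> \<Inter>\<F> \<noteq> {}" if fin: "finite \<F>" "\<F> \<subseteq> range H" for \<F>
    proof -
      obtain I where I: "finite I" "\<F> = H ` I" using finite_subset_image[OF fin] by blast
      obtain n where "\<And>i. i \<in> I \<Longrightarrow> i \<le> n" using I(1) finite_nat_set_iff_bounded_le by meson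
      hence "s n \<in> \<Inter>\<F>" using coord_s by (auto simp: I(2) H_def)
      with s_in_K[of n] show ?thesis by blast
    qed
    ultimately show ?thesis
      using assms(2) unfolding reflexive_cone_def compactin_fip by simp
  qed
  then obtain v where "\<And>i. coord e v i = a i / M" by (auto simp: H_def)
  hence "(\<lambda>i. (a i / M) *\<^sub>R e i) sums v" using coord_sums[OF assms(1), of v] by simp
  from bounded_linear.sums[OF bounded_linear_scaleR_right this, of M] M(1)
  show "summable (\<lambda>n. a n *\<^sub>R e n)" by (auto simp: sums_iff)
qed

end
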